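(* For all $m\in\mathbb{N}$, all $x,y\in\mathbb{R}$ and all $t\in\mathbb{R}^+$ with $1+p_2(x,y;t)\neq 0$, $$\bigl(1+p_2(x,y;t)\bigr)\,\partial_t^m\left(\frac{1}{1+p_2(x,y;t)}\right)=m!\;U_m\left(\frac{p_2^{(1)}(x,y;t)}{1+p_2(x,y;t)},\;\frac12\,\frac{p_2^{(2)}(x,y;t)}{1+p_2(x,y;t)}\right).$$
   Context: Here $p_2(x,y;t)=x\,t+y\,t^2$ and $p_2^{(k)}(x,y;t)=\partial_t^k p_2(x,y;t)$. The two-variable Hermite polynomials are $H_n(x,y)=n!\sum_{r=0}^{\lfloor n/2\rfloor}\frac{x^{n-2r}y^r}{(n-2r)!\,r!}$. The two-variable Chebyshev polynomials of the second kind are defined for $x,y\in\mathbb{R}$, $n\in\mathbb{N}$ (including $0$) by $$U_n(x,y)=\frac{1}{n!}\int_0^\infty e^{-s}H_n(-sx,-sy)\,ds=(-1)^n\sum_{r=0}^{\lfloor n/2\rfloor}\frac{(n-r)!\,x^{n-2r}(-y)^r}{(n-2r)!\,r!}.$$ *)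

theory Defs
  imports "HOL-Analysis.Analysis"
begin

definition p2 :: "real \<Rightarrow> real \<Rightarrow> real \<Rightarrow> real" where
  "p2 x y t = x * t + y * t\<^sup>2"

definition p2_deriv :: "nat \<Rightarrow> real \<Rightarrow> real \<Rightarrow> real \<Rightarrow> real" where
  "p2_deriv k x y t = (deriv ^^ k) (\<lambda>s. p2 x y s) t"

definition hermite2 :: "nat \<Rightarrow> real \<Rightarrow> real \<Rightarrow> real" where
  "hermite2 n x y =
     fact n * (\<Sum>r = 0..n div 2. x ^ (n - 2 * r) * y ^ r / (fact (n - 2 * r) * fact r))"

definition chebyshevU2 :: "nat \<Rightarrow> real \<Rightarrow> real \<Rightarrow> real" where
  "chebyshevU2 n x y =
     1 / fact n * (LBINT s:{0..}. exp (- s) * hermite2 n (- s * x) (- s * y))"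

lemma exp_power_integral:
  "set_integrable lborel {0..} (\<lambda>s::real. exp (- s) * s ^ k)"
  "(LBINT s:{0..}. exp (- s) * s ^ k) = (fact k :: real)"
proof -
  have eq: "exp (- s) * s ^ k = s powr (real (Suc k) - 1) / exp s" if "s \<in> {0..} - {0}" for s :: real
    using that by (simp add: powr_realpow exp_minus field_simps)
  have "((\<lambda>s. s powr (real (Suc k) - 1) / exp s) has_integral Gamma (real (Suc k))) {0..}"
    by (rule Gamma_integral_real) simp
  then have hi: "((\<lambda>s::real. exp (- s) * s ^ k) has_integral fact k) {0..}"
    by (subst has_integral_spike_finite_eq[of "{0}"]) (auto simp: eq simp flip: Gamma_fact)
  have "(\<lambda>s::real. exp (- s) * s ^ k) absolutely_integrable_on {0..}"
    by (rule nonnegative_absolutely_integrable_1) (use hi in auto)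
  then show int: "set_integrable lborel {0..} (\<lambda>s::real. exp (- s) * s ^ k)"
    unfolding set_integrable_def
    by (subst (asm) integrable_completion) (auto intro!: borel_measurable_continuous_onI continuous_intros)
  show "(LBINT s:{0..}. exp (- s) * s ^ k) = (fact k :: real)"
    using set_borel_integral_eq_integral(2)[OF int] hi by (simp add: integral_unique)
qed

lemma chebyshevU2_explicit:
  "chebyshevU2 n x y =
     (- 1) ^ n * (\<Sum>r = 0..n div 2.
        fact (n - r) * x ^ (n - 2 * r) * (- y) ^ r / (fact (n - 2 * r) * fact r))"
proof -
  define c :: "nat \<Rightarrow> real" where
    "c r = (- 1) ^ n * x ^ (n - 2 * r) * (- y) ^ r / (fact (n - 2 * r) * fact r)" for r
  have sgn: "(- s * x) ^ (n - 2 * r) * (- s * y) ^ r / (fact (n - 2 * r) * fact r) = c r * s ^ (n - r)"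
    if "r \<le> n div 2" for r and s :: real
  proof -
    have le: "2 * r \<le> n" using that by simp
    have e: "(- 1 :: real) ^ n = (- 1) ^ (n - 2 * r)"
      using le by (simp add: minus_one_power_iff)
    have "s ^ (n - r) = s ^ (n - 2 * r) * s ^ r"
      using le by (simp flip: power_add)
    moreover have "(- s * x) ^ (n - 2 * r) = (- 1) ^ n * s ^ (n - 2 * r) * x ^ (n - 2 * r)"
      unfolding e by (simp flip: power_mult_distrib)
    moreover have "(- s * y) ^ r = s ^ r * (- y) ^ r"
      by (simp flip: power_mult_distrib)
    ultimately show ?thesis by (simp add: c_def)
  qed
  have "exp (- s) * hermite2 n (- s * x) (- s * y)
          = (\<Sum>r = 0..n div 2. (fact n * c r) * (exp (- s) * s ^ (n - r)))" for s
    unfolding hermite2_def sum_distrib_left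
    by (intro sum.cong refl, subst sgn) (auto simp: mult_ac)
  then have "(LBINT s:{0..}. exp (- s) * hermite2 n (- s * x) (- s * y))
      = (LBINT s:{0..}. \<Sum>r = 0..n div 2. (fact n * c r) * (exp (- s) * s ^ (n - r)))"
    by simp
  also have "\<dots> = (\<Sum>r = 0..n div 2. LBINT s:{0..}. (fact n * c r) * (exp (- s) * s ^ (n - r)))"
    unfolding set_lebesgue_integral_def scaleR_sum_right
    using set_integrable_mult_right[OF exp_power_integral(1)]
    by (intro Bochner_Integration.integral_sum) (simp add: set_integrable_def)
  also have "\<dots> = (\<Sum>r = 0..n div 2. fact n * c r * fact (n - r))"
    by (simp only: set_integral_mult_right exp_power_integral(2))
  finally show ?thesis
    by (simp add: chebyshevU2_def c_def sum_distrib_left mult_ac)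
qed

end

theory Submission
  imports Defs
begin

text \<open>
  Write \<open>P = 1 + p\<^sub>2\<close> and \<open>W\<^sub>n = U\<^sub>n(P'/P, P''/(2P)) / P\<close>. The three-term recurrence
  \<open>U\<^sub>n\<^sub>+\<^sub>2(a, b) = - a U\<^sub>n\<^sub>+\<^sub>1(a, b) - b U\<^sub>n(a, b)\<close> says that
  \<open>P W\<^sub>n\<^sub>+\<^sub>2 + P' W\<^sub>n\<^sub>+\<^sub>1 + y W\<^sub>n = 0\<close>. Differentiating this relation shows by induction that
  \<open>W\<^sub>n' = (n + 1) W\<^sub>n\<^sub>+\<^sub>1\<close>, hence \<open>n! W\<^sub>n\<close> is the \<open>n\<close>-th derivative of \<open>W\<^sub>0 = 1 / P\<close>.
\<close>

text \<open>As \<open>n\<close> and \<open>n - 2 * r\<close> have the same parity, the sign moves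
  into \<open>(- a) ^ (n - 2 * r)\<close>, and the factorials form a binomial coefficient. The range
  \<open>r \<le> n\<close> spares the recurrence a parity split.\<close>

lemma chebyshevU2_binomial:
  "chebyshevU2 n a b = (\<Sum>r\<le>n. of_nat ((n - r) choose r) * (- a) ^ (n - 2 * r) * (- b) ^ r)"
proof -
  have "chebyshevU2 n a b
      = (\<Sum>r = 0..n div 2. of_nat ((n - r) choose r) * (- a) ^ (n - 2 * r) * (- b) ^ r)"
    unfolding chebyshevU2_explicit sum_distrib_left
  proof (rule sum.cong)
    fix r assume "r \<in> {0..n div 2}"
    then have r: "2 * r \<le> n" by auto
    then have "real ((n - r) choose r) = fact (n - r) / (fact r * fact (n - 2 * r))"
      by (subst binomial_fact) (auto simp: mult_2)
    moreover have "(- a) ^ (n - 2 * r) = (- 1) ^ n * a ^ (n - 2 * r)"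
      using r by (subst power_minus) (simp add: minus_one_power_iff)
    ultimately show "(- 1) ^ n * (fact (n - r) * a ^ (n - 2 * r) * (- b) ^ r / (fact (n - 2 * r) * fact r))
        = of_nat ((n - r) choose r) * (- a) ^ (n - 2 * r) * (- b) ^ r"
      by (simp add: mult_ac)
  qed simp
  also have "\<dots> = (\<Sum>r\<le>n. of_nat ((n - r) choose r) * (- a) ^ (n - 2 * r) * (- b) ^ r)"
    \<comment> \<open>For \<open>2 * r > n\<close> the upper index \<open>n - r\<close> is below
      \<open>r\<close>, so the added terms vanish.\<close>
    by (rule sum.mono_neutral_left) auto
  finally show ?thesis .
qed

lemma chebyshevU2_0 [simp]: "chebyshevU2 0 a b = 1"
  by (simp add: chebyshevU2_binomial)

lemma chebyshevU2_1 [simp]: "chebyshevU2 (Suc 0) a b = - a"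
  by (simp add: chebyshevU2_binomial)

text \<open>Pascal's rule splits each coefficient of index \<open>Suc r\<close> into one of index
  \<open>Suc r\<close> from degree \<open>Suc n\<close> and one of index \<open>r\<close> from
  degree \<open>n\<close>.\<close>

lemma chebyshevU2_Suc_Suc:
  "chebyshevU2 (Suc (Suc n)) a b = - a * chebyshevU2 (Suc n) a b - b * chebyshevU2 n a b"
proof -
  define c where "c n r = real ((n - r) choose r) * (- a) ^ (n - 2 * r) * (- b) ^ r" for n r
  have U: "chebyshevU2 n a b = (\<Sum>r\<le>n. c n r)" for n
    by (simp add: chebyshevU2_binomial c_def)
  have pascal: "c (Suc (Suc n)) (Suc r) = - a * c (Suc n) (Suc r) - b * c n r" if "r \<le> n" for r
  proof -
    have "Suc n - r = Suc (n - r)" using that by simp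
    then have "c (Suc (Suc n)) (Suc r) =
        real ((n - r) choose Suc r) * (- a) ^ (n - 2 * r) * (- b) ^ Suc r - b * c n r"
      by (simp add: c_def algebra_simps)
    moreover have "real ((n - r) choose Suc r) * (- a) ^ (n - 2 * r) * (- b) ^ Suc r
        = - a * c (Suc n) (Suc r)"
    \<comment> \<open>The exponent \<open>Suc n - 2 * Suc r\<close> is truncated to 0 once
      \<open>2 * r \<ge> n\<close>; there the binomial coefficient is 0 on both sides.\<close>
    proof (cases "2 * r < n")
      case True
      then have "n - 2 * r = Suc (Suc n - 2 * Suc r)" by simp
      then show ?thesis by (simp add: c_def)
    next
      case False
      then have "(n - r) choose Suc r = 0" by (intro binomial_eq_0) simp
      then show ?thesis by (simp only: c_def) simp
    qed
    ultimately show ?thesis by simp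
  qed
  have "chebyshevU2 (Suc (Suc n)) a b
      = c (Suc (Suc n)) 0 + (\<Sum>r\<le>n. c (Suc (Suc n)) (Suc r)) + c (Suc (Suc n)) (Suc (Suc n))"
    unfolding U by (subst sum.atMost_Suc_shift) simp
  also have "(\<Sum>r\<le>n. c (Suc (Suc n)) (Suc r))
      = - a * (\<Sum>r\<le>n. c (Suc n) (Suc r)) - b * (\<Sum>r\<le>n. c n r)"
    by (simp add: pascal sum_subtractf sum_negf flip: sum_distrib_left)
  also have "c (Suc (Suc n)) 0 = - a * c (Suc n) 0"
    by (simp add: c_def)
  also have "c (Suc (Suc n)) (Suc (Suc n)) = 0"
    by (simp add: c_def)
  also have "- a * c (Suc n) 0 + (- a * (\<Sum>r\<le>n. c (Suc n) (Suc r)) - b * (\<Sum>r\<le>n. c n r)) + 0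
      = - a * (c (Suc n) 0 + (\<Sum>r\<le>n. c (Suc n) (Suc r))) - b * (\<Sum>r\<le>n. c n r)"
    by (simp add: algebra_simps)
  also have "c (Suc n) 0 + (\<Sum>r\<le>n. c (Suc n) (Suc r)) = chebyshevU2 (Suc n) a b"
    unfolding U by (subst sum.atMost_Suc_shift) simp
  finally show ?thesis by (simp add: U)
qed

lemma has_field_derivative_p2 [derivative_intros]:
  "((\<lambda>s. p2 x y s) has_field_derivative x + 2 * y * s) (at s)"
  unfolding p2_def by (auto intro!: derivative_eq_intros)

lemma p2_deriv_1: "p2_deriv 1 x y t = x + 2 * y * t"
  by (simp add: p2_deriv_def DERIV_imp_deriv has_field_derivative_p2)

lemma p2_deriv_2: "p2_deriv 2 x y t = 2 * y"
proof -
  have "deriv (\<lambda>s. p2 x y s) = (\<lambda>s. x + 2 * y * s)"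
    by (intro ext DERIV_imp_deriv has_field_derivative_p2)
  moreover have "deriv (\<lambda>s. x + 2 * y * s) t = 2 * y"
    by (rule DERIV_imp_deriv) (auto intro!: derivative_eq_intros)
  ultimately show ?thesis
    by (simp add: p2_deriv_def numeral_2_eq_2)
qed

text \<open>This is \<open>W\<^sub>n\<close>, with \<open>P'\<close> and \<open>P'' / 2\<close>
  written out; where \<open>P\<close> is nonzero it is the \<open>n\<close>-th Taylor coefficient of
  \<open>1 / P\<close> at \<open>s\<close>.\<close>

definition recip_p2_taylor :: "nat \<Rightarrow> real \<Rightarrow> real \<Rightarrow> real \<Rightarrow> real" where
  "recip_p2_taylor n x y s =
     chebyshevU2 n ((x + 2 * y * s) / (1 + p2 x y s)) (y / (1 + p2 x y s)) / (1 + p2 x y s)"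

lemma recip_p2_taylor_Suc_Suc:
  "recip_p2_taylor (Suc (Suc n)) x y s =
     - ((x + 2 * y * s) * recip_p2_taylor (Suc n) x y s + y * recip_p2_taylor n x y s) / (1 + p2 x y s)"
proof -
  have "(- (D / P) * u - y / P * v) / P = - (D * (u / P) + y * (v / P)) / P" for D P u v :: real
    by (simp add: divide_simps)
  then show ?thesis
    by (simp only: recip_p2_taylor_def chebyshevU2_Suc_Suc)
qed

text \<open>The recurrence has order two, so the induction starts from \<open>n = 0\<close> and
  \<open>n = 1\<close>; the step applies the quotient rule to the recurrence solved for its top
  term.\<close>

lemma has_field_derivative_recip_p2_taylor:
  assumes "1 + p2 x y s \<noteq> 0"
  shows "(recip_p2_taylor n x y has_field_derivative
           of_nat (Suc n) * recip_p2_taylor (Suc n) x y s) (at s)"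
proof -
  define P where "P = 1 + p2 x y s"
  define D where "D = x + 2 * y * s"
  define W where "W k = recip_p2_taylor k x y s" for k
  have P: "P \<noteq> 0" using assms by (simp add: P_def)
  have dP: "((\<lambda>s. 1 + p2 x y s) has_field_derivative D) (at s)"
    unfolding D_def by (auto intro!: derivative_eq_intros)
  have dD: "((\<lambda>s. x + 2 * y * s) has_field_derivative 2 * y) (at s)"
    by (auto intro!: derivative_eq_intros)
  have W: "W (Suc (Suc k)) = - (D * W (Suc k) + y * W k) / P" for k
    unfolding W_def D_def P_def by (rule recip_p2_taylor_Suc_Suc)
  have W0: "W 0 = 1 / P" and W1: "W (Suc 0) = - D / P / P"
    by (simp_all add: W_def P_def D_def recip_p2_taylor_def del: minus_add_distrib)
  show ?thesis
  proof (induction n rule: induct_nat_012)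
    case 0
    have "recip_p2_taylor 0 x y = (\<lambda>s. 1 / (1 + p2 x y s))"
      by (simp add: recip_p2_taylor_def fun_eq_iff)
    moreover have "((\<lambda>s. 1 / (1 + p2 x y s)) has_field_derivative (0 * P - 1 * D) / (P * P)) (at s)"
      unfolding P_def by (rule DERIV_divide[OF DERIV_const dP assms])
    moreover have "(0 * P - 1 * D) / (P * P) = of_nat (Suc 0) * W (Suc 0)"
      by (simp add: W1)
    ultimately show ?case by (simp only: W_def)
  next
    case 1
    have "recip_p2_taylor (Suc 0) x y = (\<lambda>s. - (x + 2 * y * s) / ((1 + p2 x y s) * (1 + p2 x y s)))"
      by (simp add: recip_p2_taylor_def fun_eq_iff del: minus_add_distrib)
    moreover have "((\<lambda>s. - (x + 2 * y * s) / ((1 + p2 x y s) * (1 + p2 x y s))) has_field_derivative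
        (- (2 * y) * (P * P) - (- D) * (D * P + D * P)) / ((P * P) * (P * P))) (at s)"
      using P unfolding P_def D_def
      by (intro DERIV_divide DERIV_minus DERIV_mult dD dP[unfolded D_def]) simp
    moreover have "(- (2 * y) * (P * P) - (- D) * (D * P + D * P)) / ((P * P) * (P * P))
        = of_nat (Suc (Suc 0)) * W (Suc (Suc 0))"
      using P by (simp add: W[of 0] W0 W1 field_simps)
    ultimately show ?case by (simp only: W_def)
  next
    case (ge2 n)
    let ?N = "\<lambda>s. - ((x + 2 * y * s) * recip_p2_taylor (Suc n) x y s + y * recip_p2_taylor n x y s)"
    let ?N' = "- ((2 * y * W (Suc n) + of_nat (Suc (Suc n)) * W (Suc (Suc n)) * D)
        + y * (of_nat (Suc n) * W (Suc n)))"
    have NP: "- (D * W (Suc n) + y * W n) = P * W (Suc (Suc n))"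
      using P by (simp add: W[of n])
    \<comment> \<open>An equality on all of the real line: at zeros of \<open>1 + p2 x y s\<close>
      both sides are 0, by the convention for division by 0.\<close>
    have taylor: "recip_p2_taylor (Suc (Suc n)) x y = (\<lambda>s. ?N s / (1 + p2 x y s))"
      by (intro ext recip_p2_taylor_Suc_Suc)
    have "(?N has_field_derivative ?N') (at s)"
      unfolding D_def W_def
      by (intro DERIV_minus DERIV_add DERIV_mult DERIV_cmult dD ge2.IH)
    then have deriv: "(recip_p2_taylor (Suc (Suc n)) x y has_field_derivative
        (?N' * P - ?N s * D) / (P * P)) (at s)"
      unfolding taylor P_def by (rule DERIV_divide[OF _ dP assms])
    have Ns: "?N s = P * W (Suc (Suc n))"
      using NP by (simp only: W_def D_def)
    \<comment> \<open>The terms \<open>D * W (Suc (Suc n))\<close> occur \<open>(n + 2) + 1\<close>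
      times and \<open>y * W (Suc n)\<close> occurs \<open>2 + (n + 1)\<close> times, so
      \<open>n + 3\<close> factors out of the next instance of the recurrence.\<close>
    have "(?N' * P - P * W (Suc (Suc n)) * D) / (P * P)
        = of_nat (Suc (Suc (Suc n))) * W (Suc (Suc (Suc n)))"
      using P by (simp add: W[of "Suc n"] divide_simps) (simp add: algebra_simps)
    from deriv[unfolded Ns this] show ?case unfolding W_def .
  qed
qed

lemma funpow_deriv_recip_p2:
  assumes "1 + p2 x y s \<noteq> 0"
  shows "(deriv ^^ n) (\<lambda>s. 1 / (1 + p2 x y s)) s = fact n * recip_p2_taylor n x y s"
  using assms
proof (induction n arbitrary: s)
  case 0
  then show ?case by (simp add: recip_p2_taylor_def)
next
  case (Suc n)
  have "continuous_on UNIV (\<lambda>s. 1 + p2 x y s)"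
    unfolding p2_def by (intro continuous_intros)
  then have "open {s. 1 + p2 x y s \<noteq> 0}"
    by (intro open_Collect_neq) auto
  \<comment> \<open>Differentiating the induction hypothesis requires it on a whole neighbourhood of
    \<open>s\<close>, hence the openness of the nonvanishing set.\<close>
  then have "\<forall>\<^sub>F u in nhds s. 1 + p2 x y u \<noteq> 0"
    using Suc.prems eventually_nhds_in_open[of "{s. 1 + p2 x y s \<noteq> 0}" s] by simp
  then have "\<forall>\<^sub>F u in nhds s.
      (deriv ^^ n) (\<lambda>s. 1 / (1 + p2 x y s)) u = fact n * recip_p2_taylor n x y u"
    by eventually_elim (rule Suc.IH)
  then have "deriv ((deriv ^^ n) (\<lambda>s. 1 / (1 + p2 x y s))) s
      = deriv (\<lambda>u. fact n * recip_p2_taylor n x y u) s"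
    by (rule deriv_cong_ev) simp
  also have "\<dots> = fact n * (of_nat (Suc n) * recip_p2_taylor (Suc n) x y s)"
    by (rule DERIV_imp_deriv[OF DERIV_cmult[OF has_field_derivative_recip_p2_taylor[OF Suc.prems]]])
  finally show ?case by (simp add: mult_ac)
qed

theorem proposition1:
  fixes m :: nat and x y t :: real
  assumes "t > 0"
    and "1 + p2 x y t \<noteq> 0"
  shows "(1 + p2 x y t) * (deriv ^^ m) (\<lambda>s. 1 / (1 + p2 x y s)) t
       = fact m * chebyshevU2 m (p2_deriv 1 x y t / (1 + p2 x y t))
                                (1 / 2 * (p2_deriv 2 x y t / (1 + p2 x y t)))"
  using assms(2)
  \<comment> \<open>The factor \<open>1 / 2\<close> turns the second derivative \<open>2 * y\<close>
    into \<open>y\<close>, and the leading \<open>1 + p2 x y t\<close> cancels the outer division in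
    \<open>recip_p2_taylor\<close>.\<close>
  by (simp add: funpow_deriv_recip_p2 recip_p2_taylor_def p2_deriv_1[simplified] p2_deriv_2)

end
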